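(* Let $X$ be a non-empty connected compact metric space and let $f\colon X\to X$ be a continuous map. Then the following conditions are equivalent: (a) $X=CC(f)$, i.e. $f$ is chain continuous at every point of $X$; (b) $\bigcap_{i\ge0}f^i(X)$ is a singleton.
   Context: $(X,d)$ is a compact metric space and $f\colon X\to X$ is continuous. For $\delta>0$, a sequence $(x_i)_{i\ge0}$ in $X$ is a $\delta$-pseudo orbit of $f$ if $\sup_{i\ge0}d(f(x_i),x_{i+1})\le\delta$. $f$ is chain continuous at $x\in X$ if for every $\epsilon>0$ there is $\delta>0$ such that every $\delta$-pseudo orbit $(x_i)_{i\ge0}$ of $f$ with $x_0=x$ satisfies $\sup_{i\ge0}d(x_i,f^i(x))\le\epsilon$; $CC(f)$ is the set of points at which $f$ is chain continuous. *)

theory Defs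
  imports "HOL-Analysis.Analysis"
begin

text \<open>
  The ambient space is a subset \<open>X\<close> of a type of class \<open>metric_space\<close>; values of \<open>f\<close> outside \<open>X\<close>
  are irrelevant. A bound \<open>sup\<^sub>i a\<^sub>i \<le> c\<close> is written out as \<open>\<forall>i. a\<^sub>i \<le> c\<close>, because \<open>Sup\<close> on the
  reals is unspecified for unbounded sets.
\<close>

definition pseudo_orbit :: "'a::metric_space set \<Rightarrow> ('a \<Rightarrow> 'a) \<Rightarrow> real \<Rightarrow> (nat \<Rightarrow> 'a) \<Rightarrow> bool" where
  "pseudo_orbit X f \<delta> x \<longleftrightarrow> (\<forall>i. x i \<in> X) \<and> (\<forall>i. dist (f (x i)) (x (Suc i)) \<le> \<delta>)"

definition chain_continuous_at :: "'a::metric_space set \<Rightarrow> ('a \<Rightarrow> 'a) \<Rightarrow> 'a \<Rightarrow> bool" where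
  "chain_continuous_at X f x \<longleftrightarrow>
     (\<forall>\<epsilon>>0. \<exists>\<delta>>0. \<forall>y. pseudo_orbit X f \<delta> y \<and> y 0 = x \<longrightarrow> (\<forall>i. dist (y i) ((f ^^ i) x) \<le> \<epsilon>))"

definition CC :: "'a::metric_space set \<Rightarrow> ('a \<Rightarrow> 'a) \<Rightarrow> 'a set" where
  "CC X f = {x \<in> X. chain_continuous_at X f x}"

end

theory Submission
  imports Defs
begin

text \<open>
  If \<open>\<Inter>\<^sub>i f\<^sup>i(X)\<close> is a point, then some \<open>f\<^sup>N(X)\<close> is small; a pseudo orbit follows true orbits for
  \<open>N\<close> steps from each of its points, so it always stays near \<open>f\<^sup>N(X)\<close>.

  Conversely, chain continuity everywhere is uniform by compactness, and in particular the iterates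
  of \<open>f\<close> are equicontinuous. Connect \<open>a\<close> to \<open>b\<close> by a fine chain \<open>z\<^sub>0, \<dots>, z\<^sub>m\<close>. By
  equicontinuity, \<open>f\<^sup>i(z\<^sub>i)\<close>, continued by \<open>f\<^sup>i(z\<^sub>m)\<close> for \<open>i \<ge> m\<close>, is a pseudo orbit starting at \<open>a\<close>, so
  \<open>f\<^sup>i(a)\<close> and \<open>f\<^sup>i(b)\<close> are close for all \<open>i \<ge> m\<close>. A second use of compactness makes \<open>m\<close> independent
  of \<open>a\<close> and \<open>b\<close>.
\<close>

section \<open>Iterates of a self-map and nested compact sets\<close>

lemma funpow_in_set:
  assumes "f \<in> X \<rightarrow> X" "x \<in> X"
  shows "(f ^^ n) x \<in> X"
  using assms by (induction n) auto

lemma continuous_on_funpow: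
  fixes f :: "'a::topological_space \<Rightarrow> 'a"
  assumes "continuous_on X f" "f \<in> X \<rightarrow> X"
  shows "continuous_on X (f ^^ n)"
proof (induction n)
  case 0
  then show ?case by simp
next
  case (Suc n)
  have "(f ^^ n) ` X \<subseteq> X"
    using funpow_in_set[OF assms(2)] by blast
  then show ?case
    using continuous_on_compose[OF Suc continuous_on_subset[OF assms(1)]] by simp
qed

lemma funpow_image_antimono:
  assumes "f \<in> X \<rightarrow> X" "m \<le> n"
  shows "(f ^^ n) ` X \<subseteq> (f ^^ m) ` X"
proof -
  have "(f ^^ n) x = (f ^^ m) ((f ^^ (n - m)) x)" for x
    using assms(2) funpow_add[of m "n - m" f] by simp
  then show ?thesis
    using funpow_in_set[OF assms(1)] by auto
qed

text \<open>The library version \<open>compact_nest\<close> requires the class \<open>heine_borel\<close>.\<close>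

lemma compact_decseq_Inter_nonempty:
  fixes K :: "nat \<Rightarrow> 'a::t2_space set"
  assumes "\<And>n. compact (K n)" "\<And>n. K n \<noteq> {}" "\<And>m n. m \<le> n \<Longrightarrow> K n \<subseteq> K m"
  shows "(\<Inter>n. K n) \<noteq> {}"
proof -
  \<comment> \<open>\<open>K 0\<close> is the compact set inside which the finite intersection
    property is applied.\<close>
  have "K 0 \<inter> (\<Inter>n\<in>UNIV. K n) \<noteq> {}"
  proof (rule compact_imp_fip_image)
    fix I :: "nat set" assume "finite I"
    then obtain N where "\<And>n. n \<in> I \<Longrightarrow> n \<le> N"
      by (auto simp: finite_nat_set_iff_bounded_le)
    then have "K N \<subseteq> K 0 \<inter> (\<Inter>n\<in>I. K n)"
      by (intro Int_greatest INT_greatest assms(3)) simp_all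
    then show "K 0 \<inter> (\<Inter>n\<in>I. K n) \<noteq> {}"
      using assms(2)[of N] by blast
  qed (simp_all add: assms(1) compact_imp_closed)
  then show ?thesis by (metis Int_empty_right)
qed

section \<open>Uniform chain continuity and equicontinuity of the iterates\<close>

lemma pseudo_orbit_mono:
  "pseudo_orbit X f \<delta> y \<Longrightarrow> \<delta> \<le> \<delta>' \<Longrightarrow> pseudo_orbit X f \<delta>' y"
  unfolding pseudo_orbit_def by (auto intro: order_trans)

lemma pseudo_orbit_shift:
  "pseudo_orbit X f \<delta> y \<Longrightarrow> pseudo_orbit X f \<delta> (\<lambda>i. y (k + i))"
  unfolding pseudo_orbit_def by simp

text \<open>Finitely many of the balls of radius \<open>\<eta> x\<close> cover \<open>X\<close>, and
  the least of the corresponding \<open>\<delta> x\<close> works everywhere because \<open>P\<close>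
  survives shrinking its first argument.\<close>

lemma compact_uniform_delta:
  fixes X :: "'a::metric_space set"
  assumes "compact X"
    and local: "\<And>x. x \<in> X \<Longrightarrow> \<exists>\<eta>>0. \<exists>\<delta>>0. \<forall>y\<in>X. dist y x < \<eta> \<longrightarrow> P \<delta> y"
    and anti: "\<And>\<delta> \<delta>' y. P \<delta>' y \<Longrightarrow> \<delta> \<le> \<delta>' \<Longrightarrow> P \<delta> y"
  shows "\<exists>\<delta>>0::real. \<forall>y\<in>X. P \<delta> y"
proof -
  obtain \<eta> \<delta> where \<eta>: "\<And>x. x \<in> X \<Longrightarrow> \<eta> x > (0::real)" and \<delta>: "\<And>x. x \<in> X \<Longrightarrow> \<delta> x > 0"
    and P: "\<And>x y. x \<in> X \<Longrightarrow> y \<in> X \<Longrightarrow> dist y x < \<eta> x \<Longrightarrow> P (\<delta> x) y"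
    using local by metis
  have "X \<subseteq> (\<Union>x\<in>X. ball x (\<eta> x))"
    using \<eta> by force
  then obtain C where C: "C \<subseteq> X" "finite C" "X \<subseteq> (\<Union>x\<in>C. ball x (\<eta> x))"
    using compactE_image[OF \<open>compact X\<close>, of X "\<lambda>x. ball x (\<eta> x)"] by auto
  \<comment> \<open>The 1 keeps \<open>Min\<close> meaningful when \<open>C\<close> is
    empty.\<close>
  define d where "d = Min (insert 1 (\<delta> ` C))"
  have "d > 0"
    using C \<delta> unfolding d_def by (subst Min_gr_iff) auto
  moreover have "P d y" if y: "y \<in> X" for y
  proof -
    obtain x where x: "x \<in> C" "dist y x < \<eta> x"
      using subsetD[OF C(3) y] by (auto simp: dist_commute)
    have "d \<le> \<delta> x"
      using C(2) x(1) unfolding d_def by (intro Min_le) auto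
    then show ?thesis
      using anti[OF P[OF _ y x(2)]] x(1) C(1) by blast
  qed
  ultimately show ?thesis by blast
qed

text \<open>By compactness it suffices to find one \<open>\<delta>\<close> that works near each
  \<open>x\<close>. A pseudo orbit from a nearby \<open>y\<close> and the true orbit of
  \<open>y\<close> both follow the orbit of \<open>x\<close> within \<open>\<epsilon> / 2\<close>
  from index 1 on.\<close>

lemma chain_continuous_uniform:
  fixes X :: "'a::metric_space set"
  assumes "compact X" "continuous_on X f" "f \<in> X \<rightarrow> X"
    and cc: "\<And>x. x \<in> X \<Longrightarrow> chain_continuous_at X f x" and "\<epsilon> > 0"
  shows "\<exists>\<delta>>0. \<forall>y. pseudo_orbit X f \<delta> y \<longrightarrow> (\<forall>i. dist (y i) ((f ^^ i) (y 0)) \<le> \<epsilon>)"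
proof -
  define P where "P \<delta> x \<longleftrightarrow> (\<forall>y. pseudo_orbit X f \<delta> y \<and> y 0 = x \<longrightarrow>
    (\<forall>i. dist (y i) ((f ^^ i) x) \<le> \<epsilon>))" for \<delta> x
  have "\<exists>\<delta>>0. \<forall>x\<in>X. P \<delta> x"
  proof (rule compact_uniform_delta[OF \<open>compact X\<close>])
    fix x assume x: "x \<in> X"
    obtain \<delta> where \<delta>: "\<delta> > 0"
      and close: "\<And>y i. pseudo_orbit X f \<delta> y \<Longrightarrow> y 0 = x \<Longrightarrow> dist (y i) ((f ^^ i) x) \<le> \<epsilon> / 2"
      using cc[OF x] \<open>\<epsilon> > 0\<close> unfolding chain_continuous_at_def by (meson half_gt_zero)
    \<comment> \<open>The first jump after the replacement is at most the error of the pseudo orbit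
      plus the distance between the images, hence \<open>\<delta> / 2\<close> for each.\<close>
    obtain \<eta> where \<eta>: "\<eta> > 0" "\<And>y. y \<in> X \<Longrightarrow> dist y x < \<eta> \<Longrightarrow> dist (f y) (f x) < \<delta> / 2"
      using assms(2) x \<delta> unfolding continuous_on_iff by (meson half_gt_zero)
    \<comment> \<open>Replacing the initial point of a pseudo orbit by the nearby point \<open>x\<close> costs only one jump.\<close>
    have near: "dist (y i) ((f ^^ i) x) \<le> \<epsilon> / 2"
      if y: "pseudo_orbit X f (\<delta> / 2) y" "dist (y 0) x < \<eta>" and "i > 0" for y i
    proof -
      have "dist (f x) (y 1) \<le> \<delta>"
      proof -
        have "dist (f (y 0)) (y 1) \<le> \<delta> / 2" "dist (f (y 0)) (f x) < \<delta> / 2"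
          using y \<eta>(2) unfolding pseudo_orbit_def by auto
        then show ?thesis
          using dist_triangle3[of "f x" "y 1" "f (y 0)"] by linarith
      qed
      moreover have "dist (f (y j)) (y (Suc j)) \<le> \<delta>" for j
        using pseudo_orbit_mono[OF y(1), of \<delta>] \<delta> unfolding pseudo_orbit_def by simp
      ultimately have "pseudo_orbit X f \<delta> (y(0 := x))"
        using y(1) x unfolding pseudo_orbit_def by auto
      from close[OF this, of i] show ?thesis
        using \<open>i > 0\<close> by simp
    qed
    have "P (\<delta> / 2) y" if "y \<in> X" "dist y x < \<eta>" for y
      unfolding P_def
    proof (intro allI impI)
      fix z i assume z: "pseudo_orbit X f (\<delta> / 2) z \<and> z 0 = y"
      \<comment> \<open>The true orbit has jumps of size 0, so \<open>near\<close> applies to it as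
        well as to \<open>z\<close>. Index 0, which \<open>near\<close> excludes, is
        trivial.\<close>
      have orb: "pseudo_orbit X f (\<delta> / 2) (\<lambda>i. (f ^^ i) y)"
        using \<delta> funpow_in_set[OF assms(3) that(1)] unfolding pseudo_orbit_def by simp
      show "dist (z i) ((f ^^ i) y) \<le> \<epsilon>"
      proof (cases "i = 0")
        case True
        then show ?thesis using z \<open>\<epsilon> > 0\<close> by simp
      next
        case False
        then show ?thesis
          using near[of z i] near[OF orb, of i] z that
            dist_triangle2[of "z i" "(f ^^ i) y" "(f ^^ i) x"] by simp
      qed
    qed
    then show "\<exists>\<eta>>0. \<exists>\<delta>>0. \<forall>y\<in>X. dist y x < \<eta> \<longrightarrow> P \<delta> y"
      using \<eta>(1) \<delta> by (meson half_gt_zero)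
  next
    show "P \<delta> y" if "P \<delta>' y" "\<delta> \<le> \<delta>'" for \<delta> \<delta>' y
      using that pseudo_orbit_mono unfolding P_def by blast
  qed
  then obtain \<delta> where "\<delta> > 0" and \<delta>: "\<And>x. x \<in> X \<Longrightarrow> P \<delta> x"
    by blast
  have "dist (y i) ((f ^^ i) (y 0)) \<le> \<epsilon>" if y: "pseudo_orbit X f \<delta> y" for y i
  proof -
    have "y 0 \<in> X"
      using y unfolding pseudo_orbit_def by blast
    then show ?thesis
      using \<delta> y unfolding P_def by blast
  qed
  then show ?thesis
    using \<open>\<delta> > 0\<close> by blast
qed

text \<open>The orbit of \<open>b\<close> with its initial point replaced by \<open>a\<close> is a
  pseudo orbit when \<open>a\<close> and \<open>b\<close> are close, so it stays near the orbit of
  \<open>a\<close>.\<close>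

lemma chain_continuous_equicontinuous:
  fixes X :: "'a::metric_space set"
  assumes "compact X" "continuous_on X f" "f \<in> X \<rightarrow> X"
    and "\<And>x. x \<in> X \<Longrightarrow> chain_continuous_at X f x" and "\<epsilon> > 0"
  shows "\<exists>\<eta>>0. \<forall>a\<in>X. \<forall>b\<in>X. dist a b < \<eta> \<longrightarrow> (\<forall>i. dist ((f ^^ i) a) ((f ^^ i) b) \<le> \<epsilon>)"
proof -
  obtain \<delta> where \<delta>: "\<delta> > 0"
    "\<And>y i. pseudo_orbit X f \<delta> y \<Longrightarrow> dist (y i) ((f ^^ i) (y 0)) \<le> \<epsilon>"
    using chain_continuous_uniform[OF assms] by blast
  obtain \<eta> where \<eta>: "\<eta> > 0"
    "\<And>a b. a \<in> X \<Longrightarrow> b \<in> X \<Longrightarrow> dist a b < \<eta> \<Longrightarrow> dist (f a) (f b) < \<delta>"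
    using compact_uniformly_continuous[OF assms(2,1)] \<delta>(1)
    unfolding uniformly_continuous_on_def by metis
  \<comment> \<open>In the minimum, \<open>\<eta>\<close> bounds the first jump and
    \<open>\<epsilon>\<close> settles \<open>i = 0\<close>.\<close>
  have "dist ((f ^^ i) a) ((f ^^ i) b) \<le> \<epsilon>"
    if ab: "a \<in> X" "b \<in> X" "dist a b < min \<eta> \<epsilon>" for a b i
  proof (cases "i = 0")
    case True
    then show ?thesis using ab by simp
  next
    case False
    define y where "y = (\<lambda>i. (f ^^ i) b)(0 := a)"
    have "pseudo_orbit X f \<delta> y"
      using ab \<delta>(1) \<eta>(2)[of a b] funpow_in_set[OF assms(3) ab(2)]
      unfolding pseudo_orbit_def y_def by auto
    from \<delta>(2)[OF this, of i] show ?thesis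
      using False by (simp add: y_def dist_commute)
  qed
  then show ?thesis
    using \<eta>(1) \<open>\<epsilon> > 0\<close> by (intro exI[of _ "min \<eta> \<epsilon>"]) auto
qed

section \<open>Connecting orbits by fine chains\<close>

text \<open>Being joined by a chain is an equivalence relation with open classes, so a connected set
  has only one class.\<close>

lemma connected_imp_chain:
  fixes X :: "'a::metric_space set"
  assumes "connected X" "a \<in> X" "b \<in> X" "\<delta> > 0"
  shows "\<exists>z m. z 0 = a \<and> z m = b \<and> (\<forall>i\<le>m. z i \<in> X) \<and> (\<forall>i<m. dist (z i) (z (Suc i)) < \<delta>)"
proof -
  define R where "R = {(x, y). x \<in> X \<and> y \<in> X \<and> dist x y < \<delta>}"
  have "(a, b) \<in> R\<^sup>*"
  proof (rule connected_equivalence_relation[OF assms(1-3)])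
    have "sym R"
      unfolding R_def sym_def by (auto simp: dist_commute)
    then show "(y, x) \<in> R\<^sup>*" if "(x, y) \<in> R\<^sup>*" for x y
      using that sym_rtrancl symD by metis
    show "(x, z) \<in> R\<^sup>*" if "(x, y) \<in> R\<^sup>*" "(y, z) \<in> R\<^sup>*" for x y z
      using that by simp
    show "\<exists>T. openin (top_of_set X) T \<and> x \<in> T \<and> (\<forall>y\<in>T. (x, y) \<in> R\<^sup>*)" if "x \<in> X" for x
    proof (intro exI conjI ballI)
      show "openin (top_of_set X) (X \<inter> ball x \<delta>)"
        by (simp add: openin_open_Int)
      show "x \<in> X \<inter> ball x \<delta>"
        using that assms(4) by simp
      show "(x, y) \<in> R\<^sup>*" if "y \<in> X \<inter> ball x \<delta>" for y
        using that \<open>x \<in> X\<close> by (auto simp: R_def)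
    qed
  qed
  then obtain m where "(a, b) \<in> R ^^ m"
    using rtrancl_imp_relpow by metis
  then obtain z where z: "z 0 = a" "z m = b" "\<And>i. i < m \<Longrightarrow> (z i, z (Suc i)) \<in> R"
    unfolding relpow_fun_conv by blast
  have "z i \<in> X" if "i \<le> m" for i
    using z assms(3) that by (cases "i = m") (auto simp: R_def)
  then show ?thesis
    using z by (auto simp: R_def)
qed

lemma chain_continuous_eventually_close:
  fixes X :: "'a::metric_space set"
  assumes "connected X" "compact X" "continuous_on X f" "f \<in> X \<rightarrow> X"
    and cc: "\<And>x. x \<in> X \<Longrightarrow> chain_continuous_at X f x"
    and "\<epsilon> > 0" and ab: "a \<in> X" "b \<in> X"
  shows "\<exists>m. \<forall>i\<ge>m. dist ((f ^^ i) b) ((f ^^ i) a) \<le> \<epsilon>"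
proof -
  obtain \<delta> where \<delta>: "\<delta> > 0"
    "\<And>y i. pseudo_orbit X f \<delta> y \<Longrightarrow> dist (y i) ((f ^^ i) (y 0)) \<le> \<epsilon>"
    using chain_continuous_uniform[OF assms(2-4) cc \<open>\<epsilon> > 0\<close>] by blast
  obtain \<eta> where \<eta>: "\<eta> > 0" "\<And>a b i. a \<in> X \<Longrightarrow> b \<in> X \<Longrightarrow> dist a b < \<eta> \<Longrightarrow>
      dist ((f ^^ i) a) ((f ^^ i) b) \<le> \<delta>"
    using chain_continuous_equicontinuous[OF assms(2-4) cc \<delta>(1)] by blast
  obtain z m where z: "z 0 = a" "z m = b" "\<And>i. i \<le> m \<Longrightarrow> z i \<in> X"
    "\<And>i. i < m \<Longrightarrow> dist (z i) (z (Suc i)) < \<eta>"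
    using connected_imp_chain[OF assms(1) ab \<eta>(1)] by blast
  \<comment> \<open>The index of \<open>z\<close> moves by one per step and freezes at
    \<open>m\<close>: \<open>y\<close> starts at \<open>a\<close> and is the orbit of
    \<open>b\<close> from time \<open>m\<close> on.\<close>
  define y where "y i = (f ^^ i) (z (min i m))" for i
  have "pseudo_orbit X f \<delta> y"
    unfolding pseudo_orbit_def
  proof (intro conjI allI)
    fix i
    show "y i \<in> X"
      unfolding y_def using funpow_in_set[OF assms(4)] z(3) by simp
    show "dist (f (y i)) (y (Suc i)) \<le> \<delta>"
    proof (cases "i < m")
      case True
      then have "min i m = i" "min (Suc i) m = Suc i" by auto
      \<comment> \<open>Since \<open>f (y i)\<close> is the iterate \<open>Suc i\<close> of
        \<open>z i\<close>, the jump compares the same iterate at two neighbours of the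
        chain.\<close>
      then show ?thesis
        using \<eta>(2)[of "z i" "z (Suc i)" "Suc i"] z(3,4) True unfolding y_def by simp
    next
      case False
      then have "min i m = m" "min (Suc i) m = m" by auto
      then show ?thesis
        using \<delta>(1) unfolding y_def by simp
    qed
  qed
  from \<delta>(2)[OF this] have "dist ((f ^^ i) b) ((f ^^ i) a) \<le> \<epsilon>" if "i \<ge> m" for i
    using that z(1,2) unfolding y_def by (metis funpow_0 min.absorb2 min_0L)
  then show ?thesis by blast
qed

text \<open>Each point of a finite \<open>\<eta>\<close>-net has its own time after which it is
  close to the orbit of \<open>a\<close>; the largest of these times serves the net, and
  equicontinuity carries the bound to all of \<open>X\<close>.\<close>

lemma chain_continuous_uniformly_close:
  fixes X :: "'a::metric_space set"
  assumes "connected X" "compact X" "continuous_on X f" "f \<in> X \<rightarrow> X"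
    and cc: "\<And>x. x \<in> X \<Longrightarrow> chain_continuous_at X f x"
    and "\<epsilon> > 0" and a: "a \<in> X"
  shows "\<exists>m. \<forall>b\<in>X. dist ((f ^^ m) b) ((f ^^ m) a) \<le> \<epsilon>"
proof -
  have "\<epsilon> / 2 > 0" using \<open>\<epsilon> > 0\<close> by simp
  obtain \<eta> where \<eta>: "\<eta> > 0" "\<And>a b i. a \<in> X \<Longrightarrow> b \<in> X \<Longrightarrow> dist a b < \<eta> \<Longrightarrow>
      dist ((f ^^ i) a) ((f ^^ i) b) \<le> \<epsilon> / 2"
    using chain_continuous_equicontinuous[OF assms(2-4) cc \<open>\<epsilon> / 2 > 0\<close>] by blast
  obtain M where M: "\<And>b i. b \<in> X \<Longrightarrow> i \<ge> M b \<Longrightarrow> dist ((f ^^ i) b) ((f ^^ i) a) \<le> \<epsilon> / 2"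
    using chain_continuous_eventually_close[OF assms(1-4) cc \<open>\<epsilon> / 2 > 0\<close> a] by metis
  have "X \<subseteq> (\<Union>x\<in>X. ball x \<eta>)"
    using \<eta>(1) by force
  then obtain C where C: "C \<subseteq> X" "finite C" "X \<subseteq> (\<Union>x\<in>C. ball x \<eta>)"
    using compactE_image[OF \<open>compact X\<close>, of X "\<lambda>x. ball x \<eta>"] by auto
  define m where "m = Max (insert 0 (M ` C))"
  have "dist ((f ^^ m) b) ((f ^^ m) a) \<le> \<epsilon>" if b: "b \<in> X" for b
  proof -
    obtain c where c: "c \<in> C" "dist b c < \<eta>"
      using subsetD[OF C(3) b] by (auto simp: dist_commute)
    have "M c \<le> m"
      using C(2) c(1) unfolding m_def by (intro Max_ge) auto
    then have "dist ((f ^^ m) c) ((f ^^ m) a) \<le> \<epsilon> / 2"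
      using M c(1) C(1) by blast
    moreover have "dist ((f ^^ m) b) ((f ^^ m) c) \<le> \<epsilon> / 2"
      using \<eta>(2)[of b c m] b c C(1) by blast
    ultimately show ?thesis
      using dist_triangle[of "(f ^^ m) b" "(f ^^ m) a" "(f ^^ m) c"] by linarith
  qed
  then show ?thesis by blast
qed

section \<open>From shrinking images to chain continuity\<close>

text \<open>For a fixed number of steps uniform continuity suffices: each step turns the error so
  far into at most \<open>\<epsilon> / 2\<close> and adds a jump of at most
  \<open>\<epsilon> / 2\<close>. The resulting \<open>\<delta>\<close> depends on
  \<open>n\<close>.\<close>

lemma pseudo_orbit_finite_shadowing:
  fixes X :: "'a::metric_space set"
  assumes "compact X" "continuous_on X f" "f \<in> X \<rightarrow> X" "\<epsilon> > 0"
  shows "\<exists>\<delta>>0. \<forall>y. pseudo_orbit X f \<delta> y \<longrightarrow> dist (y n) ((f ^^ n) (y 0)) \<le> \<epsilon>"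
  using \<open>\<epsilon> > 0\<close>
proof (induction n arbitrary: \<epsilon>)
  case 0
  then show ?case by (intro exI[of _ 1]) simp
next
  case (Suc n)
  obtain \<eta> where \<eta>: "\<eta> > 0"
    "\<And>a b. a \<in> X \<Longrightarrow> b \<in> X \<Longrightarrow> dist a b < \<eta> \<Longrightarrow> dist (f a) (f b) < \<epsilon> / 2"
    using compact_uniformly_continuous[OF assms(2,1)] half_gt_zero[OF Suc.prems]
    unfolding uniformly_continuous_on_def by metis
  obtain \<delta> where \<delta>: "\<delta> > 0"
    "\<And>y. pseudo_orbit X f \<delta> y \<Longrightarrow> dist (y n) ((f ^^ n) (y 0)) \<le> \<eta> / 2"
    using Suc.IH[OF half_gt_zero[OF \<eta>(1)]] by blast
  have "dist (y (Suc n)) ((f ^^ Suc n) (y 0)) \<le> \<epsilon>"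
    if y: "pseudo_orbit X f (min \<delta> (\<epsilon> / 2)) y" for y
  proof -
    have X: "y i \<in> X" for i
      using y unfolding pseudo_orbit_def by blast
    have "dist (y n) ((f ^^ n) (y 0)) < \<eta>"
      using \<delta>(2)[OF pseudo_orbit_mono[OF y]] \<eta>(1) by simp
    then have "dist (f (y n)) ((f ^^ Suc n) (y 0)) < \<epsilon> / 2"
      using \<eta>(2) X funpow_in_set[OF assms(3) X] by simp
    moreover have "dist (f (y n)) (y (Suc n)) \<le> \<epsilon> / 2"
      using y unfolding pseudo_orbit_def by simp
    ultimately show ?thesis
      using dist_triangle3[of "y (Suc n)" "(f ^^ Suc n) (y 0)" "f (y n)"] by linarith
  qed
  then show ?case
    using \<delta>(1) Suc.prems by (intro exI[of _ "min \<delta> (\<epsilon> / 2)"]) auto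
qed

text \<open>Errors cannot accumulate beyond \<open>N\<close> steps, because \<open>f ^^ N\<close>
  nearly forgets where it started.\<close>

lemma chain_continuous_at_if_images_shrink:
  fixes X :: "'a::metric_space set"
  assumes "compact X" "continuous_on X f" "f \<in> X \<rightarrow> X" "x \<in> X"
    and shrink: "\<And>\<epsilon>. \<epsilon> > 0 \<Longrightarrow> \<exists>n. \<forall>a\<in>X. \<forall>b\<in>X. dist ((f ^^ n) a) ((f ^^ n) b) \<le> \<epsilon>"
  shows "chain_continuous_at X f x"
  unfolding chain_continuous_at_def
proof (intro allI impI)
  fix \<epsilon> :: real assume "\<epsilon> > 0"
  then have "\<epsilon> / 2 > 0" by simp
  obtain N where N: "\<And>a b. a \<in> X \<Longrightarrow> b \<in> X \<Longrightarrow> dist ((f ^^ N) a) ((f ^^ N) b) \<le> \<epsilon> / 2"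
    using shrink[OF \<open>\<epsilon> / 2 > 0\<close>] by blast
  obtain d where d: "\<And>n. d n > 0"
    "\<And>n y. pseudo_orbit X f (d n) y \<Longrightarrow> dist (y n) ((f ^^ n) (y 0)) \<le> \<epsilon> / 2"
    using pseudo_orbit_finite_shadowing[OF assms(1-3) \<open>\<epsilon> / 2 > 0\<close>] by metis
  define \<delta> where "\<delta> = Min (d ` {..N})"
  have "\<delta> > 0"
    using d(1) unfolding \<delta>_def by (subst Min_gr_iff) auto
  have \<delta>: "\<delta> \<le> d n" if "n \<le> N" for n
    using that unfolding \<delta>_def by simp
  have "dist (y i) ((f ^^ i) x) \<le> \<epsilon>" if y: "pseudo_orbit X f \<delta> y" "y 0 = x" for y i
  proof (cases "i \<le> N")
    case True
    then show ?thesis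
      using d(2)[OF pseudo_orbit_mono[OF y(1) \<delta>[OF True]]] y(2) \<open>\<epsilon> > 0\<close> by simp
  next
    case False
    \<comment> \<open>The pseudo orbit is restarted at time \<open>k\<close>, exactly
      \<open>N\<close> steps before \<open>i\<close>. Both \<open>y k\<close> and the true point at
      time \<open>k\<close> lie in \<open>X\<close>, so their images under \<open>f ^^ N\<close> are
      close.\<close>
    then obtain k where k: "i = k + N"
      by (metis add.commute le_Suc_ex nat_le_linear)
    have "dist (y i) ((f ^^ N) (y k)) \<le> \<epsilon> / 2"
      using d(2)[OF pseudo_orbit_mono[OF pseudo_orbit_shift[OF y(1), of k] \<delta>[OF order_refl]]] k
      by simp
    moreover have "(f ^^ i) x = (f ^^ N) ((f ^^ k) x)"
      unfolding k by (simp add: add.commute[of k] funpow_add)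
    moreover have "y k \<in> X"
      using y unfolding pseudo_orbit_def by blast
    ultimately show ?thesis
      using N[OF _ funpow_in_set[OF assms(3,4)], of "y k" k]
        dist_triangle[of "y i" "(f ^^ i) x" "(f ^^ N) (y k)"] by simp
  qed
  then show "\<exists>\<delta>>0. \<forall>y. pseudo_orbit X f \<delta> y \<and> y 0 = x \<longrightarrow> (\<forall>i. dist (y i) ((f ^^ i) x) \<le> \<epsilon>)"
    using \<open>\<delta> > 0\<close> by blast
qed

text \<open>The parts of the images outside a ball around \<open>p\<close> are compact and nested.
  If none were empty, they would share a point of the intersection other than
  \<open>p\<close>.\<close>

lemma singleton_Inter_imp_images_shrink:
  fixes X :: "'a::metric_space set"
  assumes "compact X" "continuous_on X f" "f \<in> X \<rightarrow> X"
    and p: "(\<Inter>i::nat. (f ^^ i) ` X) = {p}" and "\<epsilon> > 0"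
  shows "\<exists>n. \<forall>a\<in>X. \<forall>b\<in>X. dist ((f ^^ n) a) ((f ^^ n) b) \<le> \<epsilon>"
proof -
  define K where "K n = (f ^^ n) ` X - ball p (\<epsilon> / 2)" for n
  have "\<exists>n. K n = {}"
  proof (rule ccontr)
    assume nonempty: "\<nexists>n. K n = {}"
    have "compact (K n)" for n
      unfolding K_def
      by (intro compact_diff compact_continuous_image continuous_on_funpow assms) auto
    moreover have "K n \<subseteq> K m" if "m \<le> n" for m n
      using funpow_image_antimono[OF assms(3) that] unfolding K_def by blast
    ultimately have "(\<Inter>n. K n) \<noteq> {}"
      using nonempty by (intro compact_decseq_Inter_nonempty) simp_all
    then obtain x where x: "\<And>n. x \<in> K n"
      by blast
    then have "x \<in> (\<Inter>i::nat. (f ^^ i) ` X)"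
      unfolding K_def by blast
    then have "x = p"
      unfolding p by simp
    then show False
      using x[of 0] \<open>\<epsilon> > 0\<close> unfolding K_def by simp
  qed
  then obtain n where "(f ^^ n) ` X \<subseteq> ball p (\<epsilon> / 2)"
    unfolding K_def Diff_eq_empty_iff by blast
  then have n: "dist p ((f ^^ n) a) < \<epsilon> / 2" if "a \<in> X" for a
    using that by (simp add: image_subset_iff)
  have "dist ((f ^^ n) a) ((f ^^ n) b) \<le> \<epsilon>" if "a \<in> X" "b \<in> X" for a b
    using n[OF that(1)] n[OF that(2)] dist_triangle3[of "(f ^^ n) a" "(f ^^ n) b" p] by linarith
  then show ?thesis by blast
qed

theorem proposition5p1:
  fixes X :: "'a::metric_space set" and f :: "'a \<Rightarrow> 'a"
  assumes "X \<noteq> {}" and "connected X" and "compact X"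
    and "continuous_on X f" and "f \<in> X \<rightarrow> X"
  shows "X = CC X f \<longleftrightarrow> is_singleton (\<Inter>i::nat. (f ^^ i) ` X)"
proof
  assume "X = CC X f"
  then have "X \<subseteq> CC X f"
    by (rule equalityD1)
  then have cc: "chain_continuous_at X f x" if "x \<in> X" for x
    using that unfolding CC_def by blast
  obtain a where a: "a \<in> X"
    using assms(1) by blast
  have "(\<Inter>i::nat. (f ^^ i) ` X) \<noteq> {}"
  proof (rule compact_decseq_Inter_nonempty)
    show "compact ((f ^^ n) ` X)" for n
      by (intro compact_continuous_image continuous_on_funpow assms)
    show "(f ^^ n) ` X \<noteq> {}" for n
      using assms(1) by simp
    show "(f ^^ n) ` X \<subseteq> (f ^^ m) ` X" if "m \<le> n" for m n
      by (rule funpow_image_antimono[OF assms(5) that])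
  qed
  moreover have "p = q" if pq: "p \<in> (\<Inter>i::nat. (f ^^ i) ` X)" "q \<in> (\<Inter>i::nat. (f ^^ i) ` X)" for p q
  proof (rule ccontr)
    assume "p \<noteq> q"
    \<comment> \<open>Both \<open>p\<close> and \<open>q\<close> lie in the image of
      \<open>f ^^ m\<close>, within a third of their distance from one point, so that distance would
      be at most two thirds of itself.\<close>
    then have "dist p q / 3 > 0" by simp
    then obtain m where m: "\<And>b. b \<in> X \<Longrightarrow> dist ((f ^^ m) b) ((f ^^ m) a) \<le> dist p q / 3"
      using chain_continuous_uniformly_close[OF assms(2-5) cc _ a] by blast
    have "p \<in> (f ^^ m) ` X" "q \<in> (f ^^ m) ` X"
      by (rule pq[THEN INT_D, OF UNIV_I])+
    then have "dist p ((f ^^ m) a) \<le> dist p q / 3" "dist q ((f ^^ m) a) \<le> dist p q / 3"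
      using m by blast+
    then show False
      using dist_triangle2[of p q "(f ^^ m) a"] \<open>dist p q / 3 > 0\<close> by linarith
  qed
  ultimately show "is_singleton (\<Inter>i::nat. (f ^^ i) ` X)"
    by (rule is_singletonI')
next
  assume "is_singleton (\<Inter>i::nat. (f ^^ i) ` X)"
  then obtain p where "(\<Inter>i::nat. (f ^^ i) ` X) = {p}"
    by (rule is_singletonE)
  from singleton_Inter_imp_images_shrink[OF assms(3-5) this]
  have "chain_continuous_at X f x" if "x \<in> X" for x
    using chain_continuous_at_if_images_shrink[OF assms(3-5) that] by blast
  then show "X = CC X f"
    unfolding CC_def by auto
qed

end
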